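(* Let $U=N\times(\mathbb R^{k-m}\times T^m)\stackrel{\pi}{\to}N$ be a toroidal domain of a $k$-dimensional commutative dynamical algebra $\mathcal A$, with bundle coordinates $(r^A,y^\lambda)$. For any Poisson bivector field on $U$ of rank $2k$ of the form $$w=w^{A\lambda}(r^B)\,\partial_A\wedge\partial_\lambda+w^{\mu\nu}(r^B,y^\lambda)\,\partial_\mu\wedge\partial_\nu ,$$ there exists a toroidal domain $U'\subset U$ such that $(w,\mathcal A)$ is a partially integrable system on $U'$.
   Context: Setting. $\mathcal A$ is a commutative dynamical algebra on a smooth manifold $Z$: given $k$ mutually commuting vector fields $\vartheta_\lambda$ on $Z$, independent almost everywhere (the set where $\vartheta_1\wedge\dots\wedge\vartheta_k$ vanishes is nowhere dense), $\mathcal S$ is the ring of smooth functions annihilated by all $\vartheta_\lambda$ (integrals of motion) and $\mathcal A$ is the $k$-dimensional $\mathcal S$-Lie algebra generated by the $\vartheta_\lambda$. On an open subset, $\mathcal A$ and $\mathcal S$ are understood as restricted to it. Toroidal domain $U$: an open subset of $Z$, a neighbourhood of a regular invariant manifold of $\mathcal A$ (an orbit of the flows of the $\vartheta_\lambda$ on which $\vartheta_1\wedge\dots\wedge\vartheta_k\ne0$), presented as a trivial principal bundle $\pi:U=N\times(\mathbb R^{k-m}\times T^m)\to N$ over a domain $N\subset\mathbb R^{\dim Z-k}$ whose fibers are invariant manifolds. It carries coordinates $(r^A)$ on $N$ and standard coordinates $(y^\lambda)=(t^a,\varphi^i)$, $a=1,\dots,k-m$, $i=1,\dots,m$, on $\mathbb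 R^{k-m}\times T^m$, in which $$\vartheta_a=\partial_a,\qquad \vartheta_i=-(BC^{-1})_i^a(r)\partial_a+(C^{-1})_i^k(r)\partial_k$$ with $B,C$ smooth matrix functions on $N$ and $C$ nondegenerate. Thus on $U$ one has $\mathcal S=\pi^*C^\infty(N)$ and $\mathcal A$ is generated over $\mathcal S$ by the vector fields $\partial_\lambda=\partial/\partial y^\lambda$. Here $\partial_A=\partial/\partial r^A$. A toroidal domain $U'\subset U$ is $U'=\pi^{-1}(N')$ for a domain $N'\subset N$. Partially integrable system (PIS): a $k$-dimensional commutative dynamical algebra $\mathcal A$ on a regular Poisson manifold is a PIS $(w,\mathcal A)$ if (a) $\mathcal A$ is generated (over $\mathcal S$) by the Hamiltonian vector fields of $k$ almost everywhere independent integrals of motion $H_\lambda$ in involution (the set where $dH_1\wedge\dots\wedge dH_k$ vanishes is nowhere dense), and (b) all elements of $\mathcal S$ are mutually in involution. The Hamiltonian vector field of $f$ is $-w\lfloor df$, i.e. the derivation $g\mapsto\{f,g\}$ of the Poisson bracket defined by $w$. Summation over repeated indices is understood. *)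

theory Defs
  imports "HOL-Analysis.Analysis"
begin

text \<open>
  The fibre \<open>\<real>\<^sup>k\<^sup>-\<^sup>m \<times> T\<^sup>m\<close> is modelled with one finite index type \<open>'k\<close> for all the fibre
  coordinates \<open>y\<^sup>\<lambda>\<close> and a subset \<open>I\<close> of it, with \<open>m = card I\<close>, for the angular ones:
  the component with index in \<open>I\<close> is a point of the unit circle of \<open>\<complex>\<close> (with angle
  \<open>\<phi>\<close> modulo \<open>2\<pi>\<close>), every other component is a point of the real axis of \<open>\<complex>\<close>.
  Both \<open>I = {}\<close> and \<open>I = UNIV\<close> are allowed. The base coordinates \<open>r\<^sup>A\<close> are those of
  \<open>real ^ 'n\<close>, so the total space has dimension \<open>CARD('n) + CARD('k)\<close>.
\<close>

type_synonym ('n, 'k) point = "(real ^ 'n) \<times> (complex ^ 'k)"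

definition fibre :: "'k set \<Rightarrow> (complex ^ 'k::finite) set" where
  "fibre I = {z. \<forall>l. if l \<in> I then cmod (z $ l) = 1 else Im (z $ l) = 0}"

definition total_space ::
  "'k set \<Rightarrow> (real ^ 'n::finite) set \<Rightarrow> ('n, 'k::finite) point set" where
  "total_space I N = N \<times> fibre I"

text \<open>
  \<open>Inl A\<close> is the index of the coordinate \<open>r\<^sup>A\<close> and \<open>Inr l\<close> that of \<open>y\<^sup>l\<close>.
  \<open>coord_flow I c s p\<close> increases the coordinate \<open>c\<close> of \<open>p\<close> by \<open>s\<close>, the others being
  unchanged; an angle is increased by rotating the circle. It is defined without
  choosing a branch of the angles, so partial derivatives are globally defined.
\<close>

primrec coord_flow ::
  "'k set \<Rightarrow> 'n + 'k \<Rightarrow> real \<Rightarrow> ('n::finite, 'k::finite) point \<Rightarrow> ('n, 'k) point" where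
  "coord_flow I (Inl A) s p = (fst p + s *\<^sub>R axis A 1, snd p)"
| "coord_flow I (Inr l) s p =
    (fst p,
     \<chi> j. if j = l then (if l \<in> I then cis s * snd p $ l else snd p $ l + of_real s)
          else snd p $ j)"

definition partial_deriv ::
  "'k set \<Rightarrow> 'n + 'k \<Rightarrow> (('n::finite, 'k::finite) point \<Rightarrow> real) \<Rightarrow> ('n, 'k) point \<Rightarrow> real" where
  "partial_deriv I c f p = deriv (\<lambda>s. f (coord_flow I c s p)) 0"

text \<open>
  In the following, \<open>U\<close> is meant to be an open subset of \<open>total_space I UNIV\<close>; all notions
  only depend on the values on \<open>U\<close> of the functions and tensor fields involved.
\<close>

primrec C_diff_on ::
  "'k set \<Rightarrow> ('n, 'k) point set \<Rightarrow> nat \<Rightarrow> (('n::finite, 'k::finite) point \<Rightarrow> real) \<Rightarrow> bool" where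
  "C_diff_on I U 0 f \<longleftrightarrow> continuous_on U f"
| "C_diff_on I U (Suc q) f \<longleftrightarrow>
    continuous_on U f \<and>
    (\<forall>c. (\<forall>p\<in>U. (\<lambda>s. f (coord_flow I c s p)) differentiable (at 0)) \<and>
         C_diff_on I U q (partial_deriv I c f))"

definition smooth_fun ::
  "'k set \<Rightarrow> ('n, 'k) point set \<Rightarrow> (('n::finite, 'k::finite) point \<Rightarrow> real) \<Rightarrow> bool" where
  "smooth_fun I U f \<longleftrightarrow> (\<forall>q. C_diff_on I U q f)"

text \<open>
  Vector fields, 1-forms and bivector fields are given by their components in the global
  frame \<open>\<partial>\<^sub>c\<close> and coframe \<open>dr\<^sup>A, dy\<^sup>l\<close>, the index \<open>c\<close> ranging over \<open>'n + 'k\<close>.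
\<close>

type_synonym ('n, 'k) vfield = "('n, 'k) point \<Rightarrow> real ^ ('n + 'k)"

type_synonym ('n, 'k) bivfield = "('n, 'k) point \<Rightarrow> real ^ ('n + 'k) ^ ('n + 'k)"

definition smooth_vfield ::
  "'k set \<Rightarrow> ('n, 'k) point set \<Rightarrow> ('n::finite, 'k::finite) vfield \<Rightarrow> bool" where
  "smooth_vfield I U X \<longleftrightarrow> (\<forall>c. smooth_fun I U (\<lambda>p. X p $ c))"

definition vderiv ::
  "'k set \<Rightarrow> ('n, 'k) vfield \<Rightarrow> (('n::finite, 'k::finite) point \<Rightarrow> real) \<Rightarrow> ('n, 'k) point \<Rightarrow> real"
  where "vderiv I X f p = (\<Sum>c\<in>UNIV. X p $ c * partial_deriv I c f p)"

definition lie_bracket ::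
  "'k set \<Rightarrow> ('n, 'k) vfield \<Rightarrow> ('n, 'k) vfield \<Rightarrow> ('n::finite, 'k::finite) vfield" where
  "lie_bracket I X Y p =
    (\<chi> c. vderiv I X (\<lambda>q. Y q $ c) p - vderiv I Y (\<lambda>q. X q $ c) p)"

definition differential ::
  "'k set \<Rightarrow> (('n, 'k) point \<Rightarrow> real) \<Rightarrow> ('n::finite, 'k::finite) point \<Rightarrow> real ^ ('n + 'k)" where
  "differential I f p = (\<chi> c. partial_deriv I c f p)"

text \<open>
  Components of the exterior product \<open>v\<^sub>1 \<and> \<dots> \<and> v\<^sub>k\<close> with respect to the induced basis:
  the component for the indices \<open>\<sigma> 1, \<dots>, \<sigma> k\<close> is the corresponding \<open>k \<times> k\<close> minor.
\<close>

definition exterior_product :: "('k::finite \<Rightarrow> real ^ 'd) \<Rightarrow> ('k \<Rightarrow> 'd) \<Rightarrow> real" where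
  "exterior_product v \<sigma> = det (\<chi> l j. v l $ \<sigma> j)"

definition nowhere_dense_in :: "'a::topological_space set \<Rightarrow> 'a set \<Rightarrow> bool" where
  "nowhere_dense_in U S \<longleftrightarrow> (top_of_set U) interior_of ((top_of_set U) closure_of S) = {}"

definition ae_independent_on ::
  "('n, 'k) point set \<Rightarrow> ('k \<Rightarrow> ('n::finite, 'k::finite) point \<Rightarrow> real ^ ('n + 'k)) \<Rightarrow> bool" where
  "ae_independent_on U v \<longleftrightarrow>
    nowhere_dense_in U {p \<in> U. exterior_product (\<lambda>l. v l p) = (\<lambda>\<sigma>. 0)}"

text \<open>Generators \<open>\<theta>\<^sub>l\<close> of a commutative dynamical algebra on \<open>U\<close>.\<close>

definition commutative_dynamical ::
  "'k set \<Rightarrow> ('n, 'k) point set \<Rightarrow> ('k \<Rightarrow> ('n::finite, 'k::finite) vfield) \<Rightarrow> bool" where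
  "commutative_dynamical I U \<theta> \<longleftrightarrow>
    (\<forall>l. smooth_vfield I U (\<theta> l)) \<and>
    (\<forall>l j. \<forall>p\<in>U. lie_bracket I (\<theta> l) (\<theta> j) p = 0) \<and>
    ae_independent_on U \<theta>"

definition integrals_of_motion ::
  "'k set \<Rightarrow> ('n, 'k) point set \<Rightarrow> ('k \<Rightarrow> ('n::finite, 'k::finite) vfield) \<Rightarrow>
    (('n, 'k) point \<Rightarrow> real) set" where
  "integrals_of_motion I U \<theta> =
    {f. smooth_fun I U f \<and> (\<forall>l. \<forall>p\<in>U. vderiv I (\<theta> l) f p = 0)}"

definition generated ::
  "('n, 'k) point set \<Rightarrow> (('n, 'k) point \<Rightarrow> real) set \<Rightarrow>
    ('k \<Rightarrow> ('n::finite, 'k::finite) vfield) \<Rightarrow> ('n, 'k) vfield set" where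
  "generated U S V =
    {X. \<exists>s. (\<forall>l. s l \<in> S) \<and> (\<forall>p\<in>U. X p = (\<Sum>l\<in>UNIV. s l p *\<^sub>R V l p))}"

text \<open>
  For commuting \<open>\<theta>\<^sub>l\<close> the \<open>S\<close>-linear span is closed under the Lie bracket, as all \<open>\<theta>\<^sub>l\<close>
  annihilate \<open>S\<close>; it is therefore the \<open>S\<close>-Lie algebra generated by the \<open>\<theta>\<^sub>l\<close>.
\<close>

definition dynamical_algebra ::
  "'k set \<Rightarrow> ('n, 'k) point set \<Rightarrow> ('k \<Rightarrow> ('n::finite, 'k::finite) vfield) \<Rightarrow>
    ('n, 'k) vfield set" where
  "dynamical_algebra I U \<theta> = generated U (integrals_of_motion I U \<theta>) \<theta>"

definition domain :: "'a::topological_space set \<Rightarrow> bool" where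
  "domain N \<longleftrightarrow> open N \<and> connected N \<and> N \<noteq> {}"

text \<open>
  Toroidal domain \<open>total_space I N\<close> of the algebra generated by \<open>\<theta>\<close>. The matrix functions
  are \<open>B r a j = B\<^sup>a\<^sub>j(r)\<close> with \<open>a \<notin> I\<close>, \<open>j \<in> I\<close>, and \<open>C r i j = C\<^sup>i\<^sub>j(r)\<close> with
  \<open>i, j \<in> I\<close>; upper indices number the rows, so that
  \<open>(BC\<^sup>-\<^sup>1)\<^sup>a\<^sub>i = (\<Sum>j\<in>I. B\<^sup>a\<^sub>j (C\<^sup>-\<^sup>1)\<^sup>j\<^sub>i)\<close>. \<open>C\<close> is nondegenerate as it has the inverse \<open>D\<close>.
  Smoothness of a function on \<open>N\<close> is that of its pull-back to the total space.
\<close>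

definition toroidal_domain ::
  "'k set \<Rightarrow> (real ^ 'n) set \<Rightarrow> ('k \<Rightarrow> ('n::finite, 'k::finite) vfield) \<Rightarrow> bool" where
  "toroidal_domain I N \<theta> \<longleftrightarrow>
    domain N \<and>
    (\<exists>B C D :: real ^ 'n \<Rightarrow> 'k \<Rightarrow> 'k \<Rightarrow> real.
      (\<forall>a\<in>-I. \<forall>j\<in>I. smooth_fun I (total_space I N) (\<lambda>p. B (fst p) a j)) \<and>
      (\<forall>i\<in>I. \<forall>j\<in>I. smooth_fun I (total_space I N) (\<lambda>p. C (fst p) i j)) \<and>
      (\<forall>r\<in>N. \<forall>i\<in>I. \<forall>j\<in>I.
        (\<Sum>h\<in>I. C r i h * D r h j) = (if i = j then 1 else 0) \<and>
        (\<Sum>h\<in>I. D r i h * C r h j) = (if i = j then 1 else 0)) \<and>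
      (\<forall>p \<in> total_space I N.
        (\<forall>a\<in>-I. \<theta> a p = axis (Inr a) 1) \<and>
        (\<forall>i\<in>I. \<theta> i p =
          - (\<Sum>a\<in>-I. (\<Sum>j\<in>I. B (fst p) a j * D (fst p) j i) *\<^sub>R axis (Inr a) 1)
          + (\<Sum>j\<in>I. D (fst p) j i *\<^sub>R axis (Inr j) 1))))"

text \<open>The bivector \<open>u \<and> v = u \<otimes> v - v \<otimes> u\<close>.\<close>

definition wedge :: "real ^ 'd \<Rightarrow> real ^ 'd \<Rightarrow> real ^ 'd ^ 'd" where
  "wedge u v = (\<chi> c d. u $ c * v $ d - v $ c * u $ d)"

text \<open>\<open>{f, g} = w(df, dg)\<close>\<close>

definition poisson_bracket ::
  "'k set \<Rightarrow> ('n, 'k) bivfield \<Rightarrow> (('n, 'k) point \<Rightarrow> real) \<Rightarrow> (('n, 'k) point \<Rightarrow> real) \<Rightarrow>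
    ('n::finite, 'k::finite) point \<Rightarrow> real" where
  "poisson_bracket I w f g p =
    (\<Sum>c\<in>UNIV. \<Sum>d\<in>UNIV. w p $ c $ d * partial_deriv I c f p * partial_deriv I d g p)"

text \<open>
  The Schouten--Nijenhuis bracket \<open>[w, w]\<close>, up to a nonzero constant factor depending on
  conventions. As the frame \<open>\<partial>\<^sub>c\<close> is holonomic, its components are
  \<open>w\<^sup>h\<^sup>c \<partial>\<^sub>h w\<^sup>d\<^sup>e + w\<^sup>h\<^sup>d \<partial>\<^sub>h w\<^sup>e\<^sup>c + w\<^sup>h\<^sup>e \<partial>\<^sub>h w\<^sup>c\<^sup>d\<close>; \<open>[w, w] = 0\<close> is the
  Jacobi identity of the Poisson bracket.
\<close>

definition schouten_square ::
  "'k set \<Rightarrow> ('n, 'k) bivfield \<Rightarrow> 'n + 'k \<Rightarrow> 'n + 'k \<Rightarrow> 'n + 'k \<Rightarrow>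
    ('n::finite, 'k::finite) point \<Rightarrow> real" where
  "schouten_square I w c d e p =
    (\<Sum>h\<in>UNIV. w p $ h $ c * partial_deriv I h (\<lambda>q. w q $ d $ e) p
            + w p $ h $ d * partial_deriv I h (\<lambda>q. w q $ e $ c) p
            + w p $ h $ e * partial_deriv I h (\<lambda>q. w q $ c $ d) p)"

definition poisson_bivector ::
  "'k set \<Rightarrow> ('n, 'k) point set \<Rightarrow> ('n::finite, 'k::finite) bivfield \<Rightarrow> bool" where
  "poisson_bivector I U w \<longleftrightarrow>
    (\<forall>c d. smooth_fun I U (\<lambda>p. w p $ c $ d)) \<and>
    (\<forall>p\<in>U. transpose (w p) = - w p) \<and>
    (\<forall>c d e. \<forall>p\<in>U. schouten_square I w c d e p = 0)"

definition has_rank_on ::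
  "('n, 'k) point set \<Rightarrow> ('n::finite, 'k::finite) bivfield \<Rightarrow> nat \<Rightarrow> bool" where
  "has_rank_on U w n \<longleftrightarrow> (\<forall>p\<in>U. rank (w p) = n)"

definition regular_poisson ::
  "'k set \<Rightarrow> ('n, 'k) point set \<Rightarrow> ('n::finite, 'k::finite) bivfield \<Rightarrow> bool" where
  "regular_poisson I U w \<longleftrightarrow> poisson_bivector I U w \<and> (\<exists>n. has_rank_on U w n)"

text \<open>The vector field with \<open>vderiv I (hamiltonian_vfield I w f) g = {f, g}\<close>.\<close>

definition hamiltonian_vfield ::
  "'k set \<Rightarrow> ('n, 'k) bivfield \<Rightarrow> (('n, 'k) point \<Rightarrow> real) \<Rightarrow> ('n::finite, 'k::finite) vfield" where
  "hamiltonian_vfield I w f p = (\<chi> d. \<Sum>c\<in>UNIV. w p $ c $ d * partial_deriv I c f p)"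

definition partially_integrable_system ::
  "'k set \<Rightarrow> ('n, 'k) point set \<Rightarrow> ('n, 'k) bivfield \<Rightarrow>
    ('k \<Rightarrow> ('n::finite, 'k::finite) vfield) \<Rightarrow> bool" where
  "partially_integrable_system I U w \<theta> \<longleftrightarrow>
    regular_poisson I U w \<and>
    commutative_dynamical I U \<theta> \<and>
    (\<exists>H :: 'k \<Rightarrow> ('n, 'k) point \<Rightarrow> real.
      (\<forall>l. H l \<in> integrals_of_motion I U \<theta>) \<and>
      (\<forall>l j. \<forall>p\<in>U. poisson_bracket I w (H l) (H j) p = 0) \<and>
      ae_independent_on U (\<lambda>l. differential I (H l)) \<and>
      dynamical_algebra I U \<theta> =
        generated U (integrals_of_motion I U \<theta>) (\<lambda>l. hamiltonian_vfield I w (H l))) \<and>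
    (\<forall>f \<in> integrals_of_motion I U \<theta>. \<forall>g \<in> integrals_of_motion I U \<theta>.
      \<forall>p\<in>U. poisson_bracket I w f g p = 0)"

end

theory Submission
  imports Defs
begin

text \<open>
  Write \<open>\<partial>\<^sub>\<lambda>\<close> for the fibre part of the coordinate frame, \<open>\<alpha>(r)\<close> for the matrix
  \<open>w\<^sup>A\<^sup>\<lambda>(r)\<close> and \<open>k\<close> for the fibre dimension. The generators \<open>\<theta>\<^sub>\<lambda>\<close> and the fields \<open>\<partial>\<^sub>\<lambda>\<close>
  are related by an invertible matrix of smooth functions of \<open>r\<close>
  (\<open>toroidal_domain_frame\<close>). An integral of motion is therefore a smooth function all of
  whose \<open>\<partial>\<^sub>\<lambda>\<close>-derivatives vanish (\<open>integrals_of_motion_vertical_frame\<close>), and the algebra is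
  the span of the \<open>\<partial>\<^sub>\<lambda>\<close> over the ring of these functions. Two integrals of motion are in
  involution because \<open>w\<close> has no \<open>\<partial>\<^sub>A \<and> \<partial>\<^sub>B\<close> part.

  The rank hypothesis makes \<open>\<alpha>(r)\<close> of full rank \<open>k\<close>: as the block of \<open>w\<close> along the base
  is zero, the rank of \<open>w\<close> is at most \<open>rank \<alpha> + k\<close> (\<open>rank_block_le\<close>). At a point of \<open>N\<close>
  some \<open>k\<close> rows \<open>\<sigma>\<close> of \<open>\<alpha>\<close> thus form a nonzero minor, and this minor stays nonzero on a ball
  \<open>N'\<close> (\<open>exists_domain_minor_nonzero\<close>). The Hamiltonians are the corresponding base
  coordinates: the Hamiltonian vector field of \<open>r\<^sup>A\<close> is the row
  \<open>w\<^sup>A\<^sup>\<lambda>(r) \<partial>\<^sub>\<lambda>\<close> of \<open>w\<close>, so over \<open>N'\<close> the Hamiltonian fields are again obtained from the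
  \<open>\<partial>\<^sub>\<lambda>\<close> by an invertible matrix of functions of \<open>r\<close>. By Cramer's rule the inverses of both
  matrices are smooth, so the \<open>\<theta>\<^sub>\<lambda>\<close>, the \<open>\<partial>\<^sub>\<lambda>\<close> and the Hamiltonian fields all have the same
  span over the integrals of motion (\<open>generated_eq_if_invertible\<close>).
\<close>

section \<open>Smooth functions\<close>

text \<open>
  Partial derivatives at a point of \<open>U\<close> only look along the coordinate curves through it.
  This weak form of openness is what makes them, and hence smoothness on \<open>U\<close>, depend only on
  the values of a function on \<open>U\<close>.
\<close>

definition flow_open :: "'k set \<Rightarrow> ('n::finite, 'k::finite) point set \<Rightarrow> bool" where
  "flow_open I U \<longleftrightarrow> (\<forall>p\<in>U. \<forall>c. eventually (\<lambda>s. coord_flow I c s p \<in> U) (nhds 0))"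

lemma coord_flow_0 [simp]: "coord_flow I c 0 p = p"
  by (cases c) (auto simp: prod_eq_iff vec_eq_iff)

lemma coord_flow_Inr_fibre:
  assumes "snd p \<in> fibre I"
  shows "snd (coord_flow I (Inr l) s p) \<in> fibre I"
  using assms by (auto simp: fibre_def norm_mult)

lemma flow_open_total_space:
  assumes "open N"
  shows "flow_open I (total_space I N)"
  unfolding flow_open_def
proof (intro ballI allI)
  fix p c assume p: "p \<in> total_space I N"
  show "\<forall>\<^sub>F s in nhds 0. coord_flow I c s p \<in> total_space I N"
  proof (cases c)
    case (Inl A)
    have "isCont (\<lambda>s. fst p + s *\<^sub>R axis A (1::real)) 0"
      by (intro continuous_intros)
    then have "\<forall>\<^sub>F s in nhds 0. fst p + s *\<^sub>R axis A 1 \<in> N"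
      using p assms by (auto simp: total_space_def continuous_at_open eventually_nhds)
    then show ?thesis
      using p by (auto simp: Inl total_space_def mem_Times_iff elim: eventually_mono)
  next
    case (Inr l)
    have "coord_flow I c s p \<in> total_space I N" for s
      using p coord_flow_Inr_fibre[of p I l s] by (simp add: Inr total_space_def mem_Times_iff)
    then show ?thesis by simp
  qed
qed

lemma C_diff_on_imp_continuous_on: "C_diff_on I U q f \<Longrightarrow> continuous_on U f"
  by (cases q) auto

lemma C_diff_on_SucD: "C_diff_on I U (Suc q) f \<Longrightarrow> C_diff_on I U q f"
proof (induction q arbitrary: f)
  case (Suc q)
  have "C_diff_on I U q (partial_deriv I c f)" for c
    using Suc.prems by (intro Suc.IH) simp
  then show ?case
    using Suc.prems by simp
qed simp

lemma C_diff_on_subset: "C_diff_on I U q f \<Longrightarrow> V \<subseteq> U \<Longrightarrow> C_diff_on I V q f"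
  by (induction q arbitrary: f) (auto intro: continuous_on_subset)

lemma partial_deriv_eqI:
  "((\<lambda>s. f (coord_flow I c s p)) has_real_derivative d) (at 0) \<Longrightarrow> partial_deriv I c f p = d"
  by (simp add: partial_deriv_def DERIV_imp_deriv)

lemma has_partial_deriv:
  assumes "C_diff_on I U (Suc q) f" "p \<in> U"
  shows "((\<lambda>s. f (coord_flow I c s p)) has_real_derivative partial_deriv I c f p) (at 0)"
proof -
  obtain d where "((\<lambda>s. f (coord_flow I c s p)) has_real_derivative d) (at 0)"
    using assms real_differentiable_def by (metis C_diff_on.simps(2))
  then show ?thesis
    using partial_deriv_eqI by metis
qed

lemma has_partial_deriv_cong:
  assumes "flow_open I U" "p \<in> U" "\<And>q. q \<in> U \<Longrightarrow> f q = g q"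
  shows "((\<lambda>s. f (coord_flow I c s p)) has_real_derivative d) (at 0) \<longleftrightarrow>
    ((\<lambda>s. g (coord_flow I c s p)) has_real_derivative d) (at 0)"
proof -
  have "\<forall>\<^sub>F s in nhds 0. coord_flow I c s p \<in> U"
    using assms(1,2) by (simp add: flow_open_def)
  then have "\<forall>\<^sub>F s in nhds 0. f (coord_flow I c s p) = g (coord_flow I c s p)"
    by eventually_elim (rule assms(3))
  then show ?thesis by (intro DERIV_cong_ev refl)
qed

lemma C_diff_on_cong:
  assumes "flow_open I U" "C_diff_on I U q f" "\<And>p. p \<in> U \<Longrightarrow> f p = g p"
  shows "C_diff_on I U q g"
  using assms(2,3)
proof (induction q arbitrary: f g)
  case 0
  then show ?case by (simp cong: continuous_on_cong)
next
  case (Suc q)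
  have d: "((\<lambda>s. g (coord_flow I c s p)) has_real_derivative partial_deriv I c f p) (at 0)"
    if "p \<in> U" for c p
    by (rule iffD1[OF has_partial_deriv_cong[OF assms(1) that Suc.prems(2)]
          has_partial_deriv[OF Suc.prems(1) that]])
  have "C_diff_on I U q (partial_deriv I c g)" for c
  proof (rule Suc.IH)
    show "C_diff_on I U q (partial_deriv I c f)"
      using Suc.prems(1) by simp
    show "partial_deriv I c f p = partial_deriv I c g p" if "p \<in> U" for p
      by (rule partial_deriv_eqI[OF d[OF that], symmetric])
  qed
  moreover have "(\<lambda>s. g (coord_flow I c s p)) differentiable (at 0)" if "p \<in> U" for c p
    using d[OF that] real_differentiable_def by blast
  moreover have "continuous_on U g"
    using C_diff_on_imp_continuous_on[OF Suc.prems(1)] Suc.prems(2)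
    by (simp cong: continuous_on_cong)
  ultimately show ?case by simp
qed

text \<open>
  An introduction rule in which the partial derivatives may be given by any formula that is
  valid on \<open>U\<close>; with it the closure properties below reduce to the calculus rules and an
  induction on the order of differentiability.
\<close>

lemma C_diff_on_SucI:
  assumes "flow_open I U" "continuous_on U f"
    and "\<And>c p. p \<in> U \<Longrightarrow> ((\<lambda>s. f (coord_flow I c s p)) has_real_derivative d c p) (at 0)"
    and "\<And>c. C_diff_on I U q (d c)"
  shows "C_diff_on I U (Suc q) f"
proof -
  have "C_diff_on I U q (partial_deriv I c f)" for c
    by (rule C_diff_on_cong[OF assms(1) assms(4)[of c]])
      (rule partial_deriv_eqI[OF assms(3), symmetric])
  moreover have "(\<lambda>s. f (coord_flow I c s p)) differentiable (at 0)" if "p \<in> U" for c p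
    using assms(3)[OF that] real_differentiable_def by blast
  ultimately show ?thesis
    using assms(2) by simp
qed

lemma C_diff_on_const: "flow_open I U \<Longrightarrow> C_diff_on I U q (\<lambda>p. c)"
proof (induction q arbitrary: c)
  case (Suc q)
  show ?case
    by (rule C_diff_on_SucI[OF Suc.prems continuous_on_const DERIV_const Suc.IH[OF Suc.prems]])
qed simp

lemma C_diff_on_add:
  assumes "flow_open I U"
  shows "C_diff_on I U q f \<Longrightarrow> C_diff_on I U q g \<Longrightarrow> C_diff_on I U q (\<lambda>p. f p + g p)"
proof (induction q arbitrary: f g)
  case (Suc q)
  show ?case
  proof (rule C_diff_on_SucI[OF assms])
    show "continuous_on U (\<lambda>p. f p + g p)"
      using Suc.prems by (intro continuous_on_add C_diff_on_imp_continuous_on)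
  next
    fix c p assume "p \<in> U"
    then show "((\<lambda>s. f (coord_flow I c s p) + g (coord_flow I c s p)) has_real_derivative
      partial_deriv I c f p + partial_deriv I c g p) (at 0)"
      using Suc.prems by (intro DERIV_add has_partial_deriv)
  next
    fix c
    show "C_diff_on I U q (\<lambda>p. partial_deriv I c f p + partial_deriv I c g p)"
      using Suc by auto
  qed
qed (auto intro!: continuous_on_add)

lemma has_partial_deriv_mult:
  assumes "C_diff_on I U (Suc q) f" "C_diff_on I U (Suc q) g" "p \<in> U"
  shows "((\<lambda>s. f (coord_flow I c s p) * g (coord_flow I c s p)) has_real_derivative
      partial_deriv I c f p * g p + partial_deriv I c g p * f p) (at 0)"
  using DERIV_mult[OF has_partial_deriv[OF assms(1,3)] has_partial_deriv[OF assms(2,3)], of c c]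
  by simp

lemma C_diff_on_mult:
  assumes "flow_open I U"
  shows "C_diff_on I U q f \<Longrightarrow> C_diff_on I U q g \<Longrightarrow> C_diff_on I U q (\<lambda>p. f p * g p)"
proof (induction q arbitrary: f g)
  case (Suc q)
  show ?case
  proof (rule C_diff_on_SucI[OF assms])
    show "continuous_on U (\<lambda>p. f p * g p)"
      using Suc.prems by (intro continuous_on_mult C_diff_on_imp_continuous_on)
  next
    fix c p assume "p \<in> U"
    then show "((\<lambda>s. f (coord_flow I c s p) * g (coord_flow I c s p)) has_real_derivative
      partial_deriv I c f p * g p + partial_deriv I c g p * f p) (at 0)"
      using Suc.prems has_partial_deriv_mult by blast
  next
    fix c
    show "C_diff_on I U q (\<lambda>p. partial_deriv I c f p * g p + partial_deriv I c g p * f p)"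
      using Suc.prems C_diff_on_SucD[OF Suc.prems(1)] C_diff_on_SucD[OF Suc.prems(2)]
      by (intro C_diff_on_add[OF assms] Suc.IH) auto
  qed
qed (auto intro!: continuous_on_mult)

lemma C_diff_on_inverse:
  assumes "flow_open I U" "\<And>p. p \<in> U \<Longrightarrow> f p \<noteq> 0"
  shows "C_diff_on I U q f \<Longrightarrow> C_diff_on I U q (\<lambda>p. inverse (f p))"
proof (induction q)
  case (Suc q)
  show ?case
  proof (rule C_diff_on_SucI[OF assms(1)])
    show "continuous_on U (\<lambda>p. inverse (f p))"
      using Suc.prems assms(2) by (auto intro!: continuous_on_inverse)
  next
    fix c p assume "p \<in> U"
    then show "((\<lambda>s. inverse (f (coord_flow I c s p))) has_real_derivative
      (- 1) * (inverse (f p) * partial_deriv I c f p * inverse (f p))) (at 0)"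
      using DERIV_inverse'[OF has_partial_deriv[OF Suc.prems], of p c] assms(2) by simp
  next
    fix c
    show "C_diff_on I U q (\<lambda>p. (- 1) * (inverse (f p) * partial_deriv I c f p * inverse (f p)))"
      using Suc.prems C_diff_on_SucD[OF Suc.prems]
      by (intro C_diff_on_mult[OF assms(1)] C_diff_on_const[OF assms(1)] Suc.IH) auto
  qed
qed (use assms(2) in \<open>auto intro!: continuous_on_inverse\<close>)

lemma smooth_fun_subset: "smooth_fun I U f \<Longrightarrow> V \<subseteq> U \<Longrightarrow> smooth_fun I V f"
  by (auto simp: smooth_fun_def intro: C_diff_on_subset)

lemma smooth_fun_imp_continuous_on: "smooth_fun I U f \<Longrightarrow> continuous_on U f"
  unfolding smooth_fun_def using C_diff_on_imp_continuous_on by blast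

lemma smooth_fun_cong:
  "flow_open I U \<Longrightarrow> smooth_fun I U f \<Longrightarrow> (\<And>p. p \<in> U \<Longrightarrow> f p = g p) \<Longrightarrow> smooth_fun I U g"
  unfolding smooth_fun_def using C_diff_on_cong by blast

lemma smooth_fun_const: "flow_open I U \<Longrightarrow> smooth_fun I U (\<lambda>p. c)"
  by (simp add: smooth_fun_def C_diff_on_const)

lemma smooth_fun_add:
  "flow_open I U \<Longrightarrow> smooth_fun I U f \<Longrightarrow> smooth_fun I U g \<Longrightarrow> smooth_fun I U (\<lambda>p. f p + g p)"
  by (simp add: smooth_fun_def C_diff_on_add)

lemma smooth_fun_mult:
  "flow_open I U \<Longrightarrow> smooth_fun I U f \<Longrightarrow> smooth_fun I U g \<Longrightarrow> smooth_fun I U (\<lambda>p. f p * g p)"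
  by (simp add: smooth_fun_def C_diff_on_mult)

lemma smooth_fun_divide:
  assumes "flow_open I U" "smooth_fun I U f" "smooth_fun I U g" "\<And>p. p \<in> U \<Longrightarrow> g p \<noteq> 0"
  shows "smooth_fun I U (\<lambda>p. f p / g p)"
  unfolding divide_inverse using assms
  by (simp add: smooth_fun_def C_diff_on_mult C_diff_on_inverse)

lemma smooth_fun_sum:
  assumes "flow_open I U" "\<And>x. x \<in> S \<Longrightarrow> smooth_fun I U (f x)"
  shows "smooth_fun I U (\<lambda>p. \<Sum>x\<in>S. f x p)"
  using assms(2) by (induction S rule: infinite_finite_induct)
    (auto intro: smooth_fun_const smooth_fun_add assms(1))

lemma smooth_fun_prod:
  assumes "flow_open I U" "\<And>x. x \<in> S \<Longrightarrow> smooth_fun I U (f x)"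
  shows "smooth_fun I U (\<lambda>p. \<Prod>x\<in>S. f x p)"
  using assms(2) by (induction S rule: infinite_finite_induct)
    (auto intro: smooth_fun_const smooth_fun_mult assms(1))

lemma smooth_fun_det:
  fixes P :: "('n::finite, 'k::finite) point \<Rightarrow> real ^ 'm ^ 'm"
  assumes "flow_open I U" "\<And>i j. smooth_fun I U (\<lambda>p. P p $ i $ j)"
  shows "smooth_fun I U (\<lambda>p. det (P p))"
  unfolding det_def using assms
  by (intro smooth_fun_sum smooth_fun_mult smooth_fun_const smooth_fun_prod) auto

text \<open>
  By Cramer's rule the entries of the inverse are quotients of determinants, hence rational
  functions of the entries of \<open>P\<close> with a denominator that does not vanish on \<open>U\<close>.
\<close>

lemma smooth_fun_matrix_inverse:
  fixes P Q :: "('n::finite, 'k::finite) point \<Rightarrow> real ^ 'm ^ 'm"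
  assumes U: "flow_open I U"
    and P: "\<And>i j. smooth_fun I U (\<lambda>p. P p $ i $ j)"
    and inv: "\<And>p. p \<in> U \<Longrightarrow> P p ** Q p = mat 1"
  shows "smooth_fun I U (\<lambda>p. Q p $ i $ j)"
proof -
  have det: "det (P p) \<noteq> 0" if "p \<in> U" for p
    using inv[OF that] by (metis det_I det_mul mult_zero_left zero_neq_one)
  let ?R = "\<lambda>p. (\<chi> h l. if l = i then axis j 1 $ h else P p $ h $ l) :: real ^ 'm ^ 'm"
  have cramer: "det (?R p) / det (P p) = Q p $ i $ j" if "p \<in> U" for p
  proof -
    have "P p *v column j (Q p) = axis j 1"
      using inv[OF that]
      by (simp add: vec_eq_iff matrix_matrix_mult_def matrix_vector_mult_def
          column_def mat_def axis_def)
    then show ?thesis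
      using Determinants.cramer[OF det[OF that], of "column j (Q p)" "axis j 1"]
      by (simp add: vec_eq_iff column_def)
  qed
  have "smooth_fun I U (\<lambda>p. ?R p $ h $ l)" for h l
    using P smooth_fun_const[OF U] by (cases "l = i") simp_all
  then have "smooth_fun I U (\<lambda>p. det (?R p) / det (P p))"
    using P det by (intro smooth_fun_divide smooth_fun_det U) auto
  then show ?thesis
    by (rule smooth_fun_cong[OF U _ cramer])
qed

lemma has_partial_deriv_coordinate:
  "((\<lambda>s. fst (coord_flow I c s p) $ A) has_real_derivative axis (Inl A) 1 $ c) (at 0)"
proof (cases c)
  case (Inl B)
  have "((\<lambda>s. fst p $ A + s * axis B 1 $ A) has_real_derivative axis B 1 $ A) (at 0)"
    by (auto intro!: derivative_eq_intros)
  then show ?thesis by (simp add: Inl axis_def eq_commute)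
qed (simp add: axis_def)

lemma partial_deriv_coordinate:
  "partial_deriv I c (\<lambda>p. fst p $ A) p = axis (Inl A) 1 $ c"
  by (intro partial_deriv_eqI has_partial_deriv_coordinate)

lemma smooth_fun_coordinate:
  assumes "flow_open I U"
  shows "smooth_fun I U (\<lambda>p. fst p $ A)"
proof -
  have cont: "continuous_on U (\<lambda>p. fst p $ A)"
    by (intro continuous_intros)
  have "C_diff_on I U q (\<lambda>p. fst p $ A)" for q
  proof (cases q)
    case (Suc r)
    show ?thesis
      unfolding Suc
      by (rule C_diff_on_SucI[OF assms cont has_partial_deriv_coordinate C_diff_on_const[OF assms]])
  qed (simp add: cont)
  then show ?thesis by (simp add: smooth_fun_def)
qed

text \<open>
  Moving along a fibre coordinate does not change the base point.
\<close>

lemma partial_deriv_Inr_basic: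
  assumes "flow_open I U" "p \<in> U" "\<And>q. q \<in> U \<Longrightarrow> f q = g (fst q)"
  shows "partial_deriv I (Inr l) f p = 0"
  using has_partial_deriv_cong[OF assms(1,2), of f "\<lambda>q. g (fst q)" "Inr l" 0] assms(3)
  by (intro partial_deriv_eqI) simp

section \<open>The ring of integrals of motion\<close>

lemma partial_deriv_const [simp]: "partial_deriv I c (\<lambda>p. x) p = 0"
  by (rule partial_deriv_eqI) simp

lemma integrals_of_motion_const:
  "flow_open I U \<Longrightarrow> (\<lambda>p. x) \<in> integrals_of_motion I U \<theta>"
  by (simp add: integrals_of_motion_def smooth_fun_const vderiv_def)

lemma integrals_of_motion_add:
  assumes "flow_open I U" "f \<in> integrals_of_motion I U \<theta>" "g \<in> integrals_of_motion I U \<theta>"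
  shows "(\<lambda>p. f p + g p) \<in> integrals_of_motion I U \<theta>"
proof -
  have "vderiv I (\<theta> l) (\<lambda>p. f p + g p) p = vderiv I (\<theta> l) f p + vderiv I (\<theta> l) g p"
    if "p \<in> U" for l p
  proof -
    have "partial_deriv I c (\<lambda>p. f p + g p) p = partial_deriv I c f p + partial_deriv I c g p" for c
      using assms(2,3) that unfolding integrals_of_motion_def smooth_fun_def
      by (intro partial_deriv_eqI DERIV_add has_partial_deriv[where q = 0]) blast+
    then show ?thesis by (simp add: vderiv_def distrib_left sum.distrib)
  qed
  then show ?thesis
    using assms by (simp add: integrals_of_motion_def smooth_fun_add)
qed

lemma integrals_of_motion_mult:
  assumes "flow_open I U" "f \<in> integrals_of_motion I U \<theta>" "g \<in> integrals_of_motion I U \<theta>"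
  shows "(\<lambda>p. f p * g p) \<in> integrals_of_motion I U \<theta>"
proof -
  have "vderiv I (\<theta> l) (\<lambda>p. f p * g p) p = vderiv I (\<theta> l) f p * g p + vderiv I (\<theta> l) g p * f p"
    if "p \<in> U" for l p
  proof -
    have "partial_deriv I c (\<lambda>p. f p * g p) p =
        partial_deriv I c f p * g p + partial_deriv I c g p * f p" for c
      using assms(2,3) that unfolding integrals_of_motion_def smooth_fun_def
      by (intro partial_deriv_eqI has_partial_deriv_mult[where q = 0]) blast+
    then show ?thesis by (simp add: vderiv_def distrib_left sum.distrib sum_distrib_right mult.assoc)
  qed
  then show ?thesis
    using assms by (simp add: integrals_of_motion_def smooth_fun_mult)
qed

lemma integrals_of_motion_sum:
  assumes "flow_open I U" "\<And>x. x \<in> S \<Longrightarrow> f x \<in> integrals_of_motion I U \<theta>"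
  shows "(\<lambda>p. \<Sum>x\<in>S. f x p) \<in> integrals_of_motion I U \<theta>"
  using assms(2) by (induction S rule: infinite_finite_induct)
    (auto intro: integrals_of_motion_const integrals_of_motion_add assms(1))

section \<open>Change of generators\<close>

lemma generated_subset_if_combination:
  fixes V W :: "'k::finite \<Rightarrow> ('n::finite, 'k) vfield"
    and P :: "('n, 'k) point \<Rightarrow> real ^ 'k ^ 'k"
  assumes U: "flow_open I U"
    and P: "\<And>i j. (\<lambda>p. P p $ i $ j) \<in> integrals_of_motion I U \<theta>"
    and V: "\<And>l p. p \<in> U \<Longrightarrow> V l p = (\<Sum>j\<in>UNIV. P p $ l $ j *\<^sub>R W j p)"
  shows "generated U (integrals_of_motion I U \<theta>) V \<subseteq> generated U (integrals_of_motion I U \<theta>) W"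
proof
  fix X assume "X \<in> generated U (integrals_of_motion I U \<theta>) V"
  then obtain s where s: "\<And>l. s l \<in> integrals_of_motion I U \<theta>"
      and X: "\<And>p. p \<in> U \<Longrightarrow> X p = (\<Sum>l\<in>UNIV. s l p *\<^sub>R V l p)"
    by (auto simp: generated_def)
  have "X p = (\<Sum>j\<in>UNIV. (\<Sum>l\<in>UNIV. s l p * P p $ l $ j) *\<^sub>R W j p)" if "p \<in> U" for p
    unfolding X[OF that] V[OF that] scaleR_sum_right scaleR_sum_left scaleR_scaleR
    by (rule sum.swap)
  moreover have "(\<lambda>p. \<Sum>l\<in>UNIV. s l p * P p $ l $ j) \<in> integrals_of_motion I U \<theta>" for j
    by (intro integrals_of_motion_sum integrals_of_motion_mult U s P)
  ultimately show "X \<in> generated U (integrals_of_motion I U \<theta>) W"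
    unfolding generated_def by (intro CollectI exI[of _ "\<lambda>j p. \<Sum>l\<in>UNIV. s l p * P p $ l $ j"]) blast
qed

lemma combination_inverse:
  fixes P Q :: "real ^ 'k ^ 'k" and v w :: "'k::finite \<Rightarrow> 'a::real_vector"
  assumes "\<And>l. v l = (\<Sum>j\<in>UNIV. P $ l $ j *\<^sub>R w j)" "Q ** P = mat 1"
  shows "w i = (\<Sum>l\<in>UNIV. Q $ i $ l *\<^sub>R v l)"
proof -
  have "(\<Sum>l\<in>UNIV. Q $ i $ l *\<^sub>R v l) = (\<Sum>j\<in>UNIV. (Q ** P) $ i $ j *\<^sub>R w j)"
    unfolding assms(1) scaleR_sum_right matrix_matrix_mult_def
    by (subst sum.swap) (simp add: scaleR_sum_left)
  also have "\<dots> = (\<Sum>j\<in>UNIV. if i = j then w j else 0)"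
    unfolding assms(2) by (intro sum.cong) (auto simp: mat_def)
  finally show ?thesis by simp
qed

text \<open>
  Substituting one expansion into the other keeps the coefficients in the ring of integrals of
  motion, so each span contains the other one.
\<close>

lemma generated_eq_if_invertible:
  fixes V W :: "'k::finite \<Rightarrow> ('n::finite, 'k) vfield"
    and P Q :: "('n, 'k) point \<Rightarrow> real ^ 'k ^ 'k"
  assumes U: "flow_open I U"
    and P: "\<And>i j. (\<lambda>p. P p $ i $ j) \<in> integrals_of_motion I U \<theta>"
    and Q: "\<And>i j. (\<lambda>p. Q p $ i $ j) \<in> integrals_of_motion I U \<theta>"
    and PQ: "\<And>p. p \<in> U \<Longrightarrow> Q p ** P p = mat 1"
    and V: "\<And>l p. p \<in> U \<Longrightarrow> V l p = (\<Sum>j\<in>UNIV. P p $ l $ j *\<^sub>R W j p)"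
  shows "generated U (integrals_of_motion I U \<theta>) V = generated U (integrals_of_motion I U \<theta>) W"
proof (rule antisym)
  have "W i p = (\<Sum>l\<in>UNIV. Q p $ i $ l *\<^sub>R V l p)" if "p \<in> U" for i p
    by (rule combination_inverse[OF V[OF that] PQ[OF that]])
  then show "generated U (integrals_of_motion I U \<theta>) W
      \<subseteq> generated U (integrals_of_motion I U \<theta>) V"
    by (intro generated_subset_if_combination[OF U Q])
qed (rule generated_subset_if_combination[OF U P V])

section \<open>Minors and the rank of a block matrix\<close>

text \<open>
  A basis of the row space can be selected among the rows of \<open>M\<close>. It has as many elements as
  \<open>M\<close> has columns, so the rows in it form a square matrix of full rank.
\<close>

lemma exists_nonzero_minor:
  fixes M :: "real ^ 'k ^ 'n"
  assumes "rank M = CARD('k)"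
  obtains \<sigma> :: "'k \<Rightarrow> 'n" where "det (\<chi> l. M $ \<sigma> l) \<noteq> 0"
proof -
  obtain S where S: "S \<subseteq> rows M" "independent S" "rows M \<subseteq> span S" "card S = dim (rows M)"
    by (rule basis_exists)
  then have card: "card S = CARD('k)"
    using assms by (simp add: row_rank_def)
  then have "finite S" by (simp add: card_ge_0_finite)
  then obtain f :: "'k \<Rightarrow> real ^ 'k" where f: "bij_betw f UNIV S"
    using finite_same_card_bij[of "UNIV :: 'k set" S] card by auto
  have "\<exists>A. f l = M $ A" for l
  proof -
    have "f l \<in> rows M"
      using f S(1) by (auto simp: bij_betw_def)
    then show ?thesis by (auto simp: rows_def row_def)
  qed
  then obtain \<sigma> where \<sigma>: "\<And>l. f l = M $ \<sigma> l" by metis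
  have "rows (\<chi> l. M $ \<sigma> l) = range f"
    by (auto simp: rows_def row_def simp flip: \<sigma>)
  then have "rows (\<chi> l. M $ \<sigma> l) = S"
    using f by (simp add: bij_betw_def)
  then have "rank (\<chi> l. M $ \<sigma> l) = CARD('k)"
    using dim_eq_card_independent[OF S(2)] card by (simp add: row_rank_def)
  then have "det (\<chi> l. M $ \<sigma> l) \<noteq> 0"
    by (simp add: det_eq_0_rank)
  then show ?thesis by (rule that)
qed

lemma inj_if_minor_nonzero:
  fixes M :: "real ^ 'k ^ 'n"
  assumes "det (\<chi> l. M $ \<sigma> l) \<noteq> 0"
  shows "inj \<sigma>"
proof (rule injI, rule ccontr)
  fix i j assume "\<sigma> i = \<sigma> j" "i \<noteq> j"
  then have "det (\<chi> l. M $ \<sigma> l) = 0"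
    by (intro det_identical_rows[of i j]) (auto simp: row_def)
  with assms show False by simp
qed

text \<open>
  The columns of \<open>W\<close> with a base index are, up to sign, the rows of \<open>M\<close> padded with zeros and
  so span a space of dimension at most \<open>rank M\<close>; there are only \<open>CARD('k)\<close> other columns.
\<close>

lemma rank_block_le:
  fixes W :: "real ^ ('n::finite + 'k::finite) ^ ('n + 'k)" and M :: "real ^ 'k ^ 'n"
  assumes "\<And>A B. W $ Inl A $ Inl B = 0" "\<And>A l. W $ Inr l $ Inl A = - M $ A $ l"
  shows "rank W \<le> rank M + CARD('k)"
proof -
  define emb :: "real ^ 'k \<Rightarrow> real ^ ('n + 'k)" where
    "emb v = (\<chi> c. case c of Inl A \<Rightarrow> 0 | Inr l \<Rightarrow> - v $ l)" for v
  have lin: "linear emb"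
    by (rule linearI) (auto simp: emb_def vec_eq_iff split: sum.split)
  define S where "S = emb ` rows M"
  define T where "T = range (\<lambda>l. column (Inr l) W)"
  have "column c W \<in> span (S \<union> T)" for c
  proof (cases c)
    case (Inl A)
    have "column c W = emb (row A M)"
      using assms by (auto simp: Inl emb_def column_def row_def vec_eq_iff split: sum.split)
    moreover have "emb (row A M) \<in> S"
      by (auto simp: S_def rows_def)
    ultimately show ?thesis by (simp add: span_base)
  qed (simp add: T_def span_base)
  then have "columns W \<subseteq> span (S \<union> T)"
    by (auto simp: columns_def)
  then have "rank W \<le> dim (S \<union> T)"
    unfolding column_rank_def by (rule dim_subset[of "columns W" "span (S \<union> T)", unfolded dim_span])
  also have "\<dots> \<le> dim S + dim T"
    using dim_sums_Int[OF subspace_span[of S] subspace_span[of T]]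
    by (simp add: span_Un flip: dim_span[of "S \<union> T"])
  also have "dim S \<le> rank M"
    unfolding S_def row_rank_def by (rule dim_image_le[OF lin])
  also have "dim T \<le> CARD('k)"
    using dim_le_card'[of T] card_image_le[of UNIV "\<lambda>l. column (Inr l) W"] by (simp add: T_def)
  finally show ?thesis by simp
qed

section \<open>Vertical frames and toroidal domains\<close>

lemma sum_UNIV_Plus: "(\<Sum>c\<in>UNIV. f c) = (\<Sum>A\<in>UNIV. f (Inl A)) + (\<Sum>l\<in>UNIV. f (Inr l))"
  for f :: "'n::finite + 'k::finite \<Rightarrow> 'a::comm_monoid_add"
  using sum.Plus[of UNIV UNIV f] by (simp add: UNIV_Plus_UNIV)

lemma vertical_component:
  fixes e :: "real ^ 'k"
  shows "(\<Sum>j\<in>UNIV. e $ j *\<^sub>R axis (Inr j) 1 :: real ^ ('n::finite + 'k::finite)) $ c =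
    (case c of Inl A \<Rightarrow> 0 | Inr j \<Rightarrow> e $ j)"
  by (auto simp: axis_def if_distrib[of "\<lambda>x. _ * x"] split: sum.split cong: if_cong)

lemma vderiv_vertical:
  assumes "X p = (\<Sum>j\<in>UNIV. e $ j *\<^sub>R axis (Inr j) 1)"
  shows "vderiv I X f p = (\<Sum>j\<in>UNIV. e $ j * partial_deriv I (Inr j) f p)"
  by (simp add: vderiv_def sum_UNIV_Plus assms vertical_component del: sum_component)

text \<open>
  The derivatives along \<open>\<theta>\<close> are obtained from the derivatives along the fibre coordinates by
  applying the matrix \<open>E\<close>, which is injective.
\<close>

lemma integrals_of_motion_vertical_frame:
  assumes \<theta>: "\<And>l p. p \<in> U \<Longrightarrow> \<theta> l p = (\<Sum>j\<in>UNIV. E p $ l $ j *\<^sub>R axis (Inr j) 1)"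
    and inv: "\<And>p. p \<in> U \<Longrightarrow> F p ** E p = mat 1"
  shows "integrals_of_motion I U \<theta> =
    {f. smooth_fun I U f \<and> (\<forall>j. \<forall>p\<in>U. partial_deriv I (Inr j) f p = 0)}"
proof -
  have "(\<forall>l. vderiv I (\<theta> l) f p = 0) \<longleftrightarrow> (\<forall>j. partial_deriv I (Inr j) f p = 0)"
    if p: "p \<in> U" for f p
  proof -
    let ?g = "\<chi> j. partial_deriv I (Inr j) f p"
    have "(\<forall>l. vderiv I (\<theta> l) f p = 0) \<longleftrightarrow> E p *v ?g = 0"
      by (simp add: vderiv_vertical[where X = "\<theta> _", OF \<theta>[OF p]] vec_eq_iff matrix_vector_mult_def)
    also have "\<dots> \<longleftrightarrow> ?g = 0"
    proof
      assume "E p *v ?g = 0"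
      then have "F p *v (E p *v ?g) = 0" by simp
      then show "?g = 0"
        by (simp only: matrix_vector_mul_assoc inv[OF p] matrix_vector_mul_lid)
    qed simp
    finally show ?thesis by (simp add: vec_eq_iff)
  qed
  then show ?thesis unfolding integrals_of_motion_def by blast
qed

text \<open>
  The systems occurring in the proof are independent everywhere, and always with respect to
  one and the same minor \<open>\<tau>\<close>.
\<close>

lemma ae_independent_onI:
  assumes "\<And>p. p \<in> U \<Longrightarrow> exterior_product (\<lambda>l. v l p) \<tau> \<noteq> 0"
  shows "ae_independent_on U v"
proof -
  have empty: "{p \<in> U. exterior_product (\<lambda>l. v l p) = (\<lambda>\<sigma>. 0)} = {}"
    using assms by (auto dest: fun_cong)
  then show ?thesis
    unfolding ae_independent_on_def nowhere_dense_in_def by (simp only: empty) simp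
qed

lemma sum_split_Compl: "(\<Sum>j\<in>UNIV. f j) = (\<Sum>j\<in>I. f j) + (\<Sum>j\<in>-I. f j)"
  for I :: "'k::finite set" and f :: "'k \<Rightarrow> 'a::comm_monoid_add"
  using sum.union_disjoint[of I "-I" f] by simp

text \<open>
  The generators form, over each point, a frame of the vertical tangent space. Solving their
  defining equations gives \<open>\<partial>\<^sub>j = \<Sum>\<^sub>i C\<^sup>i\<^sub>j \<theta>\<^sub>i + \<Sum>\<^sub>a B\<^sup>a\<^sub>j \<theta>\<^sub>a\<close> for an angular \<open>j\<close>. The
  coefficient matrix \<open>F\<close> of this inverse relation is the one whose smoothness can be read off,
  since \<open>B\<close> and \<open>C\<close> are smooth by assumption while \<open>E\<close> also contains the inverse \<open>D\<close> of \<open>C\<close>.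
\<close>

lemma toroidal_domain_frame:
  fixes \<theta> :: "'k::finite \<Rightarrow> ('n::finite, 'k) vfield"
  assumes "toroidal_domain I N \<theta>"
  obtains E F :: "real ^ 'n \<Rightarrow> real ^ 'k ^ 'k"
  where "\<And>i j. smooth_fun I (total_space I N) (\<lambda>p. F (fst p) $ i $ j)"
    and "\<And>r. r \<in> N \<Longrightarrow> E r ** F r = mat 1"
    and "\<And>l p. p \<in> total_space I N \<Longrightarrow>
      \<theta> l p = (\<Sum>j\<in>UNIV. E (fst p) $ l $ j *\<^sub>R axis (Inr j) 1)"
proof -
  obtain B C D :: "real ^ 'n \<Rightarrow> 'k \<Rightarrow> 'k \<Rightarrow> real" where
      B: "\<forall>a\<in>-I. \<forall>j\<in>I. smooth_fun I (total_space I N) (\<lambda>p. B (fst p) a j)"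
    and C: "\<forall>i\<in>I. \<forall>j\<in>I. smooth_fun I (total_space I N) (\<lambda>p. C (fst p) i j)"
    and inv: "\<forall>r\<in>N. \<forall>i\<in>I. \<forall>j\<in>I.
        (\<Sum>h\<in>I. C r i h * D r h j) = (if i = j then 1 else 0) \<and>
        (\<Sum>h\<in>I. D r i h * C r h j) = (if i = j then 1 else 0)"
    and \<theta>: "\<forall>p \<in> total_space I N.
        (\<forall>a\<in>-I. \<theta> a p = axis (Inr a) 1) \<and>
        (\<forall>i\<in>I. \<theta> i p =
          - (\<Sum>a\<in>-I. (\<Sum>j\<in>I. B (fst p) a j * D (fst p) j i) *\<^sub>R axis (Inr a) 1)
          + (\<Sum>j\<in>I. D (fst p) j i *\<^sub>R axis (Inr j) 1))"
    using assms unfolding toroidal_domain_def by (elim conjE exE) (rule that)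
  have CD: "(\<Sum>h\<in>I. C r i h * D r h j) = (if i = j then 1 else 0)"
    if "r \<in> N" "i \<in> I" "j \<in> I" for r i j
    using inv that by simp
  have U: "flow_open I (total_space I N)"
    using assms by (auto simp: toroidal_domain_def domain_def intro: flow_open_total_space)
  define E :: "real ^ 'n \<Rightarrow> real ^ 'k ^ 'k" where
    "E r = (\<chi> l j. if l \<in> I then if j \<in> I then D r j l else - (\<Sum>h\<in>I. B r j h * D r h l)
                  else if l = j then 1 else 0)" for r
  define F :: "real ^ 'n \<Rightarrow> real ^ 'k ^ 'k" where
    "F r = (\<chi> j l. if j \<in> I then if l \<in> I then C r l j else B r l j
                  else if j = l then 1 else 0)" for r
  show ?thesis
  proof (rule that)
    show "smooth_fun I (total_space I N) (\<lambda>p. F (fst p) $ i $ j)" for i j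
      using B C smooth_fun_const[OF U] by (cases "i \<in> I"; cases "j \<in> I") (simp_all add: F_def)
  next
    fix r assume r: "r \<in> N"
    have "(\<Sum>j\<in>UNIV. E r $ l $ j * F r $ j $ m) = (if l = m then 1 else 0)" for l m
    proof (cases "l \<in> I")
      case l: True
      have "(\<Sum>j\<in>UNIV. E r $ l $ j * F r $ j $ m) =
          (\<Sum>j\<in>I. D r j l * (if m \<in> I then C r m j else B r m j)) +
          (\<Sum>j\<in>-I. if j = m then - (\<Sum>h\<in>I. B r j h * D r h l) else 0)"
        unfolding sum_split_Compl[of _ I]
        by (intro arg_cong2[where f = "(+)"] sum.cong) (auto simp: E_def F_def l)
      also have "\<dots> = (if l = m then 1 else 0)"
        using CD[OF r _ l, of m] l by (auto simp: mult.commute)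
      finally show ?thesis .
    next
      case False
      have "(\<Sum>j\<in>UNIV. E r $ l $ j * F r $ j $ m) = (\<Sum>j\<in>UNIV. if l = j then F r $ j $ m else 0)"
        by (intro sum.cong) (auto simp: E_def False)
      then show ?thesis by (simp add: F_def False)
    qed
    then show "E r ** F r = mat 1"
      by (simp add: matrix_matrix_mult_def mat_def vec_eq_iff)
  next
    fix l p assume p: "p \<in> total_space I N"
    show "\<theta> l p = (\<Sum>j\<in>UNIV. E (fst p) $ l $ j *\<^sub>R axis (Inr j) 1)"
    proof (cases "l \<in> I")
      case True
      then show ?thesis
        unfolding sum_split_Compl[of _ I] using \<theta> p by (simp add: E_def sum_negf)
    next
      case False
      have "(\<Sum>j\<in>UNIV. E (fst p) $ l $ j *\<^sub>R axis (Inr j) 1) =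
          (\<Sum>j\<in>UNIV. if l = j then axis (Inr j) 1 else 0 :: real ^ ('n + 'k))"
        by (intro sum.cong) (auto simp: E_def False)
      then show ?thesis using \<theta> p False by simp
    qed
  qed
qed

lemma toroidal_domain_subset:
  assumes "toroidal_domain I N \<theta>" "N' \<subseteq> N" "domain N'"
  shows "toroidal_domain I N' \<theta>"
proof -
  have sub: "total_space I N' \<subseteq> total_space I N"
    using assms(2) by (auto simp: total_space_def)
  show ?thesis
    using assms(1) unfolding toroidal_domain_def
  proof (elim conjE exE, goal_cases)
    case (1 B C D)
    show ?case
    proof (rule conjI[OF assms(3)], rule exI[of _ B], rule exI[of _ C], rule exI[of _ D], intro conjI)
      show "\<forall>a\<in>-I. \<forall>j\<in>I. smooth_fun I (total_space I N') (\<lambda>p. B (fst p) a j)"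
        using 1(2) smooth_fun_subset[OF _ sub] by simp
      show "\<forall>i\<in>I. \<forall>j\<in>I. smooth_fun I (total_space I N') (\<lambda>p. C (fst p) i j)"
        using 1(3) smooth_fun_subset[OF _ sub] by simp
    qed (rule ballI, rule bspec[OF 1(4)] bspec[OF 1(5)], erule subsetD[OF assms(2)] subsetD[OF sub])+
  qed
qed

section \<open>Bivectors without a base component\<close>

text \<open>
  Every summand involves at most one base index, and the antisymmetry of the wedge product puts
  \<open>\<alpha>\<close> into both mixed blocks, with opposite signs.
\<close>

lemma fibred_bivector_components:
  fixes \<alpha> :: "'n::finite \<Rightarrow> 'k::finite \<Rightarrow> real" and \<beta> :: "'k \<Rightarrow> 'k \<Rightarrow> real"
    and W :: "real ^ ('n + 'k) ^ ('n + 'k)"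
  assumes "W = (\<Sum>A\<in>UNIV. \<Sum>l\<in>UNIV. \<alpha> A l *\<^sub>R wedge (axis (Inl A) 1) (axis (Inr l) 1))
      + (\<Sum>l\<in>UNIV. \<Sum>j\<in>UNIV. \<beta> l j *\<^sub>R wedge (axis (Inr l) 1) (axis (Inr j) 1))"
  shows "W $ Inl A $ Inl B = 0" "W $ Inl A $ Inr l = \<alpha> A l" "W $ Inr l $ Inl A = - \<alpha> A l"
proof -
  show "W $ Inl A $ Inl B = 0"
    by (simp add: assms wedge_def axis_def)
  have "(\<Sum>B\<in>UNIV. \<Sum>m\<in>UNIV.
      \<alpha> B m * ((if A = B then 1 else 0) * (if l = m then 1 else 0))) =
      (\<Sum>B\<in>UNIV. \<Sum>m\<in>UNIV. if l = m then if A = B then \<alpha> B m else 0 else 0)"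
    by (intro sum.cong) auto
  also have "\<dots> = \<alpha> A l" by simp
  finally have "(\<Sum>B\<in>UNIV. \<Sum>m\<in>UNIV.
      \<alpha> B m * ((if A = B then 1 else 0) * (if l = m then 1 else 0))) = \<alpha> A l" .
  then show "W $ Inl A $ Inr l = \<alpha> A l" "W $ Inr l $ Inl A = - \<alpha> A l"
    by (simp_all add: assms wedge_def axis_def sum_negf mult.commute[of "if l = _ then 1 else 0"])
qed

lemma hamiltonian_vfield_coordinate: "hamiltonian_vfield I w (\<lambda>p. fst p $ A) p = w p $ Inl A"
  unfolding hamiltonian_vfield_def
  by (simp add: vec_eq_iff partial_deriv_coordinate axis_def if_distrib[of "\<lambda>x. _ * x"] cong: if_cong)

lemma exterior_product_vertical:
  "exterior_product (\<lambda>l. \<Sum>j\<in>UNIV. E $ l $ j *\<^sub>R axis (Inr j) 1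
    :: real ^ ('n::finite + 'k::finite)) Inr = det E"
  by (simp add: exterior_product_def vertical_component vec_lambda_eta del: sum_component)

lemma exterior_product_coordinates:
  assumes "inj \<sigma>"
  shows "exterior_product (\<lambda>l. differential I (\<lambda>p. fst p $ \<sigma> l) p) (\<lambda>l. Inl (\<sigma> l)) = 1"
proof -
  have "(\<chi> l j. differential I (\<lambda>p. fst p $ \<sigma> l) p $ Inl (\<sigma> j)) = (mat 1 :: real ^ 'a ^ 'a)"
    using assms by (auto simp: differential_def partial_deriv_coordinate axis_def mat_def vec_eq_iff
        dest: injD)
  then show ?thesis by (simp add: exterior_product_def)
qed

section \<open>Restriction to a smaller base and the choice of Hamiltonians\<close>

lemma regular_poisson_subset:
  assumes "poisson_bivector I U w" "has_rank_on U w n" "V \<subseteq> U"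
  shows "regular_poisson I V w"
  using assms unfolding regular_poisson_def poisson_bivector_def has_rank_on_def
  by (meson smooth_fun_subset subsetD)

lemma const_1_in_fibre: "(\<chi> l. 1) \<in> fibre I"
  by (simp add: fibre_def)

text \<open>
  The Hamiltonians are the base coordinates \<open>r\<^sup>\<sigma>\<^sup>(\<^sup>l\<^sup>)\<close> singled out by the minor. Their
  Hamiltonian vector fields are rows of \<open>w\<close>, that is, combinations of the \<open>\<partial>\<^sub>j\<close> whose
  coefficients form the matrix of the minor.
\<close>

lemma partially_integrable_if_minor_nonzero:
  fixes \<theta> :: "'k::finite \<Rightarrow> ('n::finite, 'k) vfield" and \<alpha> :: "real ^ 'n \<Rightarrow> real ^ 'k ^ 'n"
  assumes tor: "toroidal_domain I N \<theta>"
    and w: "regular_poisson I (total_space I N) w"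
    and comm: "\<And>l j p. p \<in> total_space I N \<Longrightarrow> lie_bracket I (\<theta> l) (\<theta> j) p = 0"
    and smooth: "\<And>l. smooth_vfield I (total_space I N) (\<theta> l)"
    and w_base: "\<And>A B p. p \<in> total_space I N \<Longrightarrow> w p $ Inl A $ Inl B = 0"
    and w_mixed: "\<And>A l p. p \<in> total_space I N \<Longrightarrow> w p $ Inl A $ Inr l = \<alpha> (fst p) $ A $ l"
    and minor: "\<And>r. r \<in> N \<Longrightarrow> det (\<chi> l. \<alpha> r $ \<sigma> l) \<noteq> 0"
  shows "partially_integrable_system I (total_space I N) w \<theta>"
proof -
  let ?U = "total_space I N"
  let ?S = "integrals_of_motion I ?U \<theta>"
  let ?e = "\<lambda>j p. axis (Inr j) 1 :: real ^ ('n + 'k)"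
  let ?H = "\<lambda>l p. fst p $ \<sigma> l"
  have N: "open N" "N \<noteq> {}"
    using tor by (auto simp: toroidal_domain_def domain_def)
  note U = flow_open_total_space[OF N(1), of I]
  have fst_U: "fst p \<in> N" if "p \<in> ?U" for p
    using that by (auto simp: total_space_def)
  obtain E F :: "real ^ 'n \<Rightarrow> real ^ 'k ^ 'k"
    where F: "\<And>i j. smooth_fun I ?U (\<lambda>p. F (fst p) $ i $ j)"
      and EF: "\<And>r. r \<in> N \<Longrightarrow> E r ** F r = mat 1"
      and \<theta>: "\<And>l p. p \<in> ?U \<Longrightarrow> \<theta> l p = (\<Sum>j\<in>UNIV. E (fst p) $ l $ j *\<^sub>R axis (Inr j) 1)"
    by (rule toroidal_domain_frame[OF tor]) (rule that)
  have FE: "F r ** E r = mat 1" if "r \<in> N" for r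
    using EF[OF that] by (simp add: matrix_left_right_inverse)
  have E: "smooth_fun I ?U (\<lambda>p. E (fst p) $ i $ j)" for i j
    by (rule smooth_fun_matrix_inverse[where P = "\<lambda>p. F (fst p)", OF U F FE[OF fst_U]])
  have S: "?S = {f. smooth_fun I ?U f \<and> (\<forall>j. \<forall>p\<in>?U. partial_deriv I (Inr j) f p = 0)}"
    by (rule integrals_of_motion_vertical_frame[where E = "\<lambda>p. E (fst p)" and F = "\<lambda>p. F (fst p)",
          OF \<theta> FE[OF fst_U]])
  have basic: "(\<lambda>p. g (fst p)) \<in> ?S" if "smooth_fun I ?U (\<lambda>p. g (fst p))" for g
  proof -
    have "partial_deriv I (Inr j) (\<lambda>p. g (fst p)) p = 0" if "p \<in> ?U" for j p
      by (rule partial_deriv_Inr_basic[where g = g, OF U that refl])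
    with that show ?thesis unfolding S by blast
  qed
  have E_S: "(\<lambda>p. E (fst p) $ i $ j) \<in> ?S" and F_S: "(\<lambda>p. F (fst p) $ i $ j) \<in> ?S" for i j
    using basic[of "\<lambda>r. E r $ i $ j"] basic[of "\<lambda>r. F r $ i $ j"] E F by simp_all
  have span_\<theta>: "dynamical_algebra I ?U \<theta> = generated ?U ?S ?e"
    unfolding dynamical_algebra_def
    by (rule generated_eq_if_invertible[where P = "\<lambda>p. E (fst p)" and Q = "\<lambda>p. F (fst p)",
          OF U E_S F_S FE[OF fst_U] \<theta>])
  define P where "P r = (\<chi> l. \<alpha> r $ \<sigma> l)" for r
  \<comment> \<open>The entries of \<open>P\<close> are smooth because they are components of \<open>w\<close>.\<close>
  have P: "smooth_fun I ?U (\<lambda>p. P (fst p) $ i $ j)" for i j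
  proof (rule smooth_fun_cong[OF U])
    show "smooth_fun I ?U (\<lambda>p. w p $ Inl (\<sigma> i) $ Inr j)"
      using w by (simp add: regular_poisson_def poisson_bivector_def)
  qed (simp add: w_mixed P_def)
  have "\<forall>r\<in>N. \<exists>Q. P r ** Q = mat 1 \<and> Q ** P r = mat 1"
    using minor by (simp add: P_def flip: invertible_det_nz invertible_def)
  from bchoice[OF this] obtain Q where PQ: "\<forall>r\<in>N. P r ** Q r = mat 1 \<and> Q r ** P r = mat 1"
    by (elim exE) (rule that)
  have Q: "smooth_fun I ?U (\<lambda>p. Q (fst p) $ i $ j)" for i j
    using bspec[OF PQ fst_U]
    by (intro smooth_fun_matrix_inverse[where P = "\<lambda>p. P (fst p)", OF U P]) blast
  have P_S: "(\<lambda>p. P (fst p) $ i $ j) \<in> ?S" and Q_S: "(\<lambda>p. Q (fst p) $ i $ j) \<in> ?S" for i j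
    using basic[of "\<lambda>r. P r $ i $ j"] basic[of "\<lambda>r. Q r $ i $ j"] P Q by simp_all
  have X: "hamiltonian_vfield I w (?H l) p = (\<Sum>j\<in>UNIV. P (fst p) $ l $ j *\<^sub>R axis (Inr j) 1)"
    if "p \<in> ?U" for l p
    using w_base[OF that] w_mixed[OF that]
    by (auto simp: hamiltonian_vfield_coordinate vec_eq_iff vertical_component P_def
        simp del: sum_component split: sum.split)
  have span_X: "generated ?U ?S (\<lambda>l. hamiltonian_vfield I w (?H l)) = generated ?U ?S ?e"
    by (rule generated_eq_if_invertible[where P = "\<lambda>p. P (fst p)" and Q = "\<lambda>p. Q (fst p)",
          OF U P_S Q_S _ X])
      (use bspec[OF PQ fst_U] in blast)
  have involution: "poisson_bracket I w f g p = 0" if "f \<in> ?S" "g \<in> ?S" "p \<in> ?U" for f g p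
    using that w_base[OF that(3)] by (simp add: S poisson_bracket_def sum_UNIV_Plus)
  have H: "?H l \<in> ?S" for l
    using basic[of "\<lambda>r. r $ \<sigma> l"] smooth_fun_coordinate[OF U] by simp
  have inj: "inj \<sigma>"
    using N(2) inj_if_minor_nonzero[OF minor] by auto
  have indep_\<theta>: "ae_independent_on ?U \<theta>"
  proof (rule ae_independent_onI)
    fix p assume p: "p \<in> ?U"
    have "det (E (fst p)) \<noteq> 0"
      using EF[OF fst_U[OF p]] by (metis det_I det_mul mult_zero_left zero_neq_one)
    then show "exterior_product (\<lambda>l. \<theta> l p) Inr \<noteq> 0"
      unfolding \<theta>[OF p] exterior_product_vertical .
  qed
  have indep_H: "ae_independent_on ?U (\<lambda>l. differential I (?H l))"
    by (rule ae_independent_onI[where \<tau> = "\<lambda>l. Inl (\<sigma> l)"])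
      (simp add: exterior_product_coordinates[OF inj])
  show ?thesis
    unfolding partially_integrable_system_def commutative_dynamical_def
    using w smooth comm indep_\<theta> H involution indep_H
    by (intro conjI exI[of _ ?H] allI ballI) (simp_all only: span_\<theta> span_X)
qed

text \<open>
  The rank of \<open>w\<close> at one point over \<open>r\<close>, here the point with all fibre components equal
  to \<open>1\<close>, yields a nonzero minor of \<open>\<alpha> r\<close>. Since \<open>\<alpha>\<close> is continuous, the minor does not vanish
  on a ball around \<open>r\<close>.
\<close>

lemma exists_domain_minor_nonzero:
  fixes w :: "('n::finite, 'k::finite) bivfield" and \<alpha> :: "real ^ 'n \<Rightarrow> real ^ 'k ^ 'n"
  assumes N: "open N" "r \<in> N"
    and smooth: "\<And>c d. smooth_fun I (total_space I N) (\<lambda>p. w p $ c $ d)"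
    and rank: "rank (w (r, \<chi> l. 1)) = 2 * CARD('k)"
    and w_base: "\<And>A B p. p \<in> total_space I N \<Longrightarrow> w p $ Inl A $ Inl B = 0"
    and w_mixed: "\<And>A l p. p \<in> total_space I N \<Longrightarrow> w p $ Inl A $ Inr l = \<alpha> (fst p) $ A $ l"
    and w_mixed': "\<And>A l p. p \<in> total_space I N \<Longrightarrow> w p $ Inr l $ Inl A = - \<alpha> (fst p) $ A $ l"
  obtains N' \<sigma> where "N' \<subseteq> N" "domain N'" "\<And>r. r \<in> N' \<Longrightarrow> det (\<chi> l. \<alpha> r $ \<sigma> l) \<noteq> 0"
proof -
  let ?z = "(\<chi> l. 1) :: complex ^ 'k"
  have z: "(r, ?z) \<in> total_space I N" if "r \<in> N" for r
    using that const_1_in_fibre by (auto simp: total_space_def)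
  have "2 * CARD('k) \<le> rank (\<alpha> r) + CARD('k)"
    using rank_block_le[of "w (r, ?z)" "\<alpha> r"] rank w_base[OF z] w_mixed'[OF z] N(2) by simp
  moreover have "rank (\<alpha> r) \<le> CARD('k)"
    using rank_bound[of "\<alpha> r"] by simp
  ultimately have "rank (\<alpha> r) = CARD('k)" by simp
  then obtain \<sigma> where \<sigma>: "det (\<chi> l. \<alpha> r $ \<sigma> l) \<noteq> 0"
    by (rule exists_nonzero_minor)
  let ?P = "\<lambda>p. (\<chi> l j. w p $ Inl (\<sigma> l) $ Inr j) :: real ^ 'k ^ 'k"
  \<comment> \<open>Continuity on the base is that along the section \<open>r \<mapsto> (r, ?z)\<close> of the total space.\<close>
  have "continuous_on (total_space I N) (\<lambda>p. det (?P p))"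
    by (intro smooth_fun_imp_continuous_on[of I] smooth_fun_det flow_open_total_space N)
      (simp add: smooth)
  then have "continuous_on N (\<lambda>r. det (?P (r, ?z)))"
    by (rule continuous_on_compose2) (auto intro!: continuous_intros z)
  moreover have "det (?P (r, ?z)) = det (\<chi> l. \<alpha> r $ \<sigma> l)" if "r \<in> N" for r
    using w_mixed[OF z[OF that]] by (intro arg_cong[of _ _ det]) (simp add: vec_eq_iff)
  ultimately have "continuous_on N (\<lambda>r. det (\<chi> l. \<alpha> r $ \<sigma> l))"
    by (simp cong: continuous_on_cong)
  then have "open (N \<inter> (\<lambda>r. det (\<chi> l. \<alpha> r $ \<sigma> l)) -` (- {0}))"
    by (rule continuous_open_preimage[OF _ N(1) open_Compl[OF closed_singleton]])
  moreover have "r \<in> N \<inter> (\<lambda>r. det (\<chi> l. \<alpha> r $ \<sigma> l)) -` (- {0})"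
    using N(2) \<sigma> by simp
  ultimately obtain e
    where e: "e > 0" "ball r e \<subseteq> N \<inter> (\<lambda>r. det (\<chi> l. \<alpha> r $ \<sigma> l)) -` (- {0})"
    by (rule openE)
  show ?thesis
  proof (rule that)
    show "ball r e \<subseteq> N" using e(2) by blast
    show "domain (ball r e)" using e(1) by (simp add: domain_def)
    show "det (\<chi> l. \<alpha> r' $ \<sigma> l) \<noteq> 0" if "r' \<in> ball r e" for r'
      using subsetD[OF e(2) that] by simp
  qed
qed

theorem theorem2:
  fixes I :: "'k::finite set"
    and N :: "(real ^ 'n::finite) set"
    and \<theta> :: "'k \<Rightarrow> ('n, 'k) vfield"
    and w :: "('n, 'k) bivfield"
    and a :: "real ^ 'n \<Rightarrow> 'n \<Rightarrow> 'k \<Rightarrow> real"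
    and b :: "('n, 'k) point \<Rightarrow> 'k \<Rightarrow> 'k \<Rightarrow> real"
  assumes "commutative_dynamical I (total_space I N) \<theta>"
    and "toroidal_domain I N \<theta>"
    and "poisson_bivector I (total_space I N) w"
    and "has_rank_on (total_space I N) w (2 * CARD('k))"
    and "\<forall>p \<in> total_space I N.
      w p = (\<Sum>A\<in>UNIV. \<Sum>l\<in>UNIV. a (fst p) A l *\<^sub>R wedge (axis (Inl A) 1) (axis (Inr l) 1))
          + (\<Sum>l\<in>UNIV. \<Sum>j\<in>UNIV. b p l j *\<^sub>R wedge (axis (Inr l) 1) (axis (Inr j) 1))"
  shows "\<exists>N'. N' \<subseteq> N \<and> toroidal_domain I N' \<theta> \<and>
    partially_integrable_system I (total_space I N') w \<theta>"
proof -
  let ?U = "total_space I N"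
  define \<alpha> :: "real ^ 'n \<Rightarrow> real ^ 'k ^ 'n" where "\<alpha> r = (\<chi> A l. a r A l)" for r
  have w: "w p $ Inl A $ Inl B = 0" "w p $ Inl A $ Inr l = \<alpha> (fst p) $ A $ l"
      "w p $ Inr l $ Inl A = - \<alpha> (fst p) $ A $ l" if "p \<in> ?U" for p A B l
    using fibred_bivector_components[OF assms(5)[rule_format, OF that]] by (simp_all add: \<alpha>_def)
  obtain r where r: "r \<in> N" and N: "open N"
    using assms(2) by (auto simp: toroidal_domain_def domain_def)
  have "(r, \<chi> l. 1) \<in> ?U"
    using r const_1_in_fibre by (auto simp: total_space_def)
  then have rank: "rank (w (r, \<chi> l. 1)) = 2 * CARD('k)"
    using assms(4) by (auto simp: has_rank_on_def)
  have smooth: "\<And>c d. smooth_fun I ?U (\<lambda>p. w p $ c $ d)"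
    using assms(3) by (simp add: poisson_bivector_def)
  obtain N' \<sigma> where N': "N' \<subseteq> N" "domain N'"
      and minor: "\<And>r. r \<in> N' \<Longrightarrow> det (\<chi> l. \<alpha> r $ \<sigma> l) \<noteq> 0"
    by (rule exists_domain_minor_nonzero[OF N r smooth rank w]) (assumption | rule that)+
  have sub: "total_space I N' \<subseteq> ?U"
    using N'(1) by (auto simp: total_space_def)
  have tor: "toroidal_domain I N' \<theta>"
    by (rule toroidal_domain_subset[OF assms(2) N'])
  have "partially_integrable_system I (total_space I N') w \<theta>"
  proof (rule partially_integrable_if_minor_nonzero[where \<alpha> = \<alpha> and \<sigma> = \<sigma>, OF tor])
    show "regular_poisson I (total_space I N') w"
      by (rule regular_poisson_subset[OF assms(3,4) sub])
    show "smooth_vfield I (total_space I N') (\<theta> l)" for l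
      using assms(1) sub unfolding commutative_dynamical_def smooth_vfield_def
      by (meson smooth_fun_subset)
    show "lie_bracket I (\<theta> l) (\<theta> j) p = 0" if "p \<in> total_space I N'" for l j p
      using assms(1) subsetD[OF sub that] unfolding commutative_dynamical_def by blast
    show "w p $ Inl A $ Inl B = 0" "w p $ Inl A $ Inr l = \<alpha> (fst p) $ A $ l"
      if "p \<in> total_space I N'" for A B l p
      using w(1,2) subsetD[OF sub that] by blast+
  qed (rule minor)
  with N'(1) tor show ?thesis by blast
qed

end
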